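(* Let $\widehat\rho:\mathrm{SO}(3)\to\mathrm{GL}(\mathcal{V})$ be a linear representation on a vector space $\mathcal{V}$ over $\mathbb{F}$, and let $\rho = \Pi_{\mathrm{GL}(\mathcal{V})}\circ\widehat\rho:\mathrm{SO}(3)\to\mathrm{PGL}(\mathcal{V})$ be its projection. Then the projective invariance problem for $\rho$ is equivalent to the linear invariance problem for $\widehat\rho$: for every nonzero $x\in\mathcal{V}$ with class $v\in\mathrm{P}(\mathcal{V})$, one has $\rho(R)v=v$ in $\mathrm{P}(\mathcal{V})$ for all $R\in\mathrm{SO}(3)$ if and only if $\widehat\rho(R)x=x$ in $\mathcal{V}$ for all $R\in\mathrm{SO}(3)$.
   Context: $\mathbb{F}$ denotes $\mathbb{R}$ or $\mathbb{C}$. $\mathrm{P}(\mathcal{V})$ is the set of equivalence classes of $\mathcal{V}\setminus\{0\}$ under multiplication by nonzero scalars, $\mathrm{PGL}(\mathcal{V})$ is $\mathrm{GL}(\mathcal{V})$ modulo nonzero scalar multiples of the identity, and $\Pi_{\mathrm{GL}(\mathcal{V})}:\mathrm{GL}(\mathcal{V})\to\mathrm{PGL}(\mathcal{V})$ is the projection. A linear representation is a continuous group homomorphism into $\mathrm{GL}(\mathcal{V})$ (i.e. $R\mapsto\widehat\rho(R)x$ is continuous for each $x$). *)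

theory Defs
  imports "HOL-Analysis.Analysis" "HOL-Algebra.Coset"
begin

(* No separation axiom is imposed; the Hausdorff topology of a finite-dimensional real or
   complex vector space and all normed topologies are instances. *)
locale topological_vector_space = vector_space smul
  for smul :: "'f::{field,topological_space} \<Rightarrow> 'v::topological_ab_group_add \<Rightarrow> 'v" +
  assumes continuous_scale: "continuous_on UNIV (\<lambda>(c, x). smul c x)"

definition SO3 :: "(real^3^3) monoid" where
  "SO3 = \<lparr>carrier = {R. rotation_matrix R}, mult = (**), one = mat 1\<rparr>"

definition GL :: "('f::field \<Rightarrow> 'v::ab_group_add \<Rightarrow> 'v) \<Rightarrow> ('v \<Rightarrow> 'v) monoid" where
  "GL smul = \<lparr>carrier = {g. Vector_Spaces.linear smul smul g \<and> bij g}, mult = (\<circ>), one = id\<rparr>"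

definition nonzero_scalars :: "('f::field \<Rightarrow> 'v::ab_group_add \<Rightarrow> 'v) \<Rightarrow> ('v \<Rightarrow> 'v) set" where
  "nonzero_scalars smul = {smul c |c. c \<noteq> 0}"

definition PGL :: "('f::field \<Rightarrow> 'v::ab_group_add \<Rightarrow> 'v) \<Rightarrow> ('v \<Rightarrow> 'v) set monoid" where
  "PGL smul = GL smul Mod nonzero_scalars smul"

definition PGL_proj :: "('f::field \<Rightarrow> 'v::ab_group_add \<Rightarrow> 'v) \<Rightarrow> ('v \<Rightarrow> 'v) \<Rightarrow> ('v \<Rightarrow> 'v) set" where
  "PGL_proj smul g = nonzero_scalars smul #>\<^bsub>GL smul\<^esub> g"

definition proj_rel :: "('f::field \<Rightarrow> 'v::ab_group_add \<Rightarrow> 'v) \<Rightarrow> ('v \<times> 'v) set" where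
  "proj_rel smul = {(x, y). x \<noteq> 0 \<and> y \<noteq> 0 \<and> (\<exists>c. c \<noteq> 0 \<and> y = smul c x)}"

definition proj_space :: "('f::field \<Rightarrow> 'v::ab_group_add \<Rightarrow> 'v) \<Rightarrow> 'v set set" where
  "proj_space smul = (UNIV - {0}) // proj_rel smul"

definition proj_class :: "('f::field \<Rightarrow> 'v::ab_group_add \<Rightarrow> 'v) \<Rightarrow> 'v \<Rightarrow> 'v set" where
  "proj_class smul x = proj_rel smul `` {x}"

(* The action of PGL(V) on P(V), for a class C of maps and a class v of vectors: all g x with
   g in C and x in v form a single class. The lemma PGL_act_proj_class below says that this is
   the action induced by that of GL(V) on V. *)
definition PGL_act :: "('v \<Rightarrow> 'v) set \<Rightarrow> 'v set \<Rightarrow> 'v set" where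
  "PGL_act C v = {g x |g x. g \<in> C \<and> x \<in> v}"

(* GL(V) consists of all linear bijections, with no continuity condition on each of them. *)
definition linear_representation ::
  "('f::{field,topological_space} \<Rightarrow> 'v::topological_ab_group_add \<Rightarrow> 'v) \<Rightarrow>
   (real^3^3 \<Rightarrow> 'v \<Rightarrow> 'v) \<Rightarrow> bool" where
  "linear_representation smul \<rho>h \<longleftrightarrow>
     topological_vector_space smul \<and>
     \<rho>h \<in> hom SO3 (GL smul) \<and>
     (\<forall>x. continuous_on (carrier SO3) (\<lambda>R. \<rho>h R x))"

lemma SO3_group: "group SO3"
proof (rule groupI)
  fix R assume R: "R \<in> carrier SO3"
  then have "transpose R \<in> carrier SO3" "transpose R ** R = mat 1"
    by (auto simp: SO3_def rotation_matrix_def orthogonal_matrix_def)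
  then show "\<exists>S\<in>carrier SO3. S \<otimes>\<^bsub>SO3\<^esub> R = \<one>\<^bsub>SO3\<^esub>"
    by (auto simp: SO3_def)
qed (auto simp: SO3_def rotation_matrix_def orthogonal_matrix_mul det_mul
      orthogonal_matrix_id matrix_mul_assoc)

lemma GL_group:
  assumes "vector_space smul"
  shows "group (GL smul)"
proof -
  interpret vector_space smul by fact
  show ?thesis
  proof (rule groupI)
    fix g assume g: "g \<in> carrier (GL smul)"
    then have lin: "Vector_Spaces.linear smul smul g" and "bij g"
      by (auto simp: GL_def)
    interpret g: Vector_Spaces.linear smul smul g by fact
    have "Vector_Spaces.linear smul smul (inv_into UNIV g)"
    proof unfold_locales
      show "inv_into UNIV g (x + y) = inv_into UNIV g x + inv_into UNIV g y" for x y
        using \<open>bij g\<close> by (intro inv_f_eq) (auto simp: g.add bij_is_inj bij_is_surj surj_f_inv_f)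
      show "inv_into UNIV g (smul c x) = smul c (inv_into UNIV g x)" for c x
        using \<open>bij g\<close> by (intro inv_f_eq) (auto simp: g.scale bij_is_inj bij_is_surj surj_f_inv_f)
    qed
    then show "\<exists>h\<in>carrier (GL smul). h \<otimes>\<^bsub>GL smul\<^esub> g = \<one>\<^bsub>GL smul\<^esub>"
      using \<open>bij g\<close> by (intro bexI[of _ "inv_into UNIV g"])
        (auto simp: GL_def bij_imp_bij_inv bij_is_inj)
  qed (auto simp: GL_def o_assoc Vector_Spaces.linear_compose bij_comp linear_id linear_ident id_def bij_id[unfolded id_def])
qed

lemma nonzero_scalars_normal:
  assumes "vector_space smul"
  shows "nonzero_scalars smul \<lhd> GL smul"
proof -
  interpret vector_space smul by fact
  interpret G: group "GL smul" by (rule GL_group) fact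
  have sub: "subgroup (nonzero_scalars smul) (GL smul)"
  proof (rule G.subgroupI)
    show carr: "nonzero_scalars smul \<subseteq> carrier (GL smul)"
    proof
      fix g assume "g \<in> nonzero_scalars smul"
      then obtain c where c: "c \<noteq> 0" "g = smul c" by (auto simp: nonzero_scalars_def)
      have "bij (smul c)"
        using c by (intro o_bij[of "smul (inverse c)"]) auto
      then show "g \<in> carrier (GL smul)"
        using c linear_scale_self by (auto simp: GL_def)
    qed
    show "nonzero_scalars smul \<noteq> {}"
      unfolding nonzero_scalars_def using zero_neq_one by (metis (mono_tags, lifting) empty_Collect_eq)
    show "inv\<^bsub>GL smul\<^esub> g \<in> nonzero_scalars smul" if g: "g \<in> nonzero_scalars smul" for g
    proof -
      obtain c where c: "c \<noteq> 0" "g = smul c" using g by (auto simp: nonzero_scalars_def)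
      have i: "smul (inverse c) \<in> nonzero_scalars smul"
        using c by (auto simp: nonzero_scalars_def intro: exI[of _ "inverse c"])
      have "inv\<^bsub>GL smul\<^esub> g = smul (inverse c)"
        using c i g carr by (intro G.inv_equality) (auto simp: GL_def)
      then show ?thesis using i by simp
    qed
    show "g \<otimes>\<^bsub>GL smul\<^esub> h \<in> nonzero_scalars smul"
      if gh: "g \<in> nonzero_scalars smul" "h \<in> nonzero_scalars smul" for g h
    proof -
      obtain c d where "c \<noteq> 0" "d \<noteq> 0" "g = smul c" "h = smul d"
        using gh by (auto simp: nonzero_scalars_def)
      then have "c * d \<noteq> 0" "g \<otimes>\<^bsub>GL smul\<^esub> h = smul (c * d)"
        by (auto simp: GL_def)
      then show ?thesis by (auto simp: nonzero_scalars_def)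
    qed
  qed
  show ?thesis
  proof (rule G.normalI[OF sub], intro ballI)
    fix g assume "g \<in> carrier (GL smul)"
    then interpret g: Vector_Spaces.linear smul smul g by (simp add: GL_def)
    have "smul c \<circ> g = g \<circ> smul c" for c by (auto simp: g.scale)
    then show "nonzero_scalars smul #>\<^bsub>GL smul\<^esub> g = g <#\<^bsub>GL smul\<^esub> nonzero_scalars smul"
      by (auto simp: r_coset_def l_coset_def GL_def nonzero_scalars_def)
  qed
qed

lemma PGL_proj_hom:
  assumes "vector_space smul"
  shows "PGL_proj smul \<in> hom (GL smul) (PGL smul)"
  using normal.r_coset_hom_Mod[OF nonzero_scalars_normal[OF assms]]
  by (simp add: PGL_def PGL_proj_def[abs_def])

lemma proj_rel_equiv:
  assumes "vector_space smul"
  shows "equiv (UNIV - {0}) (proj_rel smul)"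
proof -
  interpret vector_space smul by fact
  show ?thesis
  proof (rule equivI)
    show "proj_rel smul \<subseteq> (UNIV - {0}) \<times> (UNIV - {0})" by (auto simp: proj_rel_def)
    show "refl_on (UNIV - {0}) (proj_rel smul)"
      by (auto simp: refl_on_def proj_rel_def intro: exI[of _ 1])
    show "sym (proj_rel smul)"
    proof (rule symI)
      fix x y assume "(x, y) \<in> proj_rel smul"
      then obtain c where "x \<noteq> 0" "y \<noteq> 0" "c \<noteq> 0" "y = smul c x" by (auto simp: proj_rel_def)
      then show "(y, x) \<in> proj_rel smul"
        by (auto simp: proj_rel_def intro!: exI[of _ "inverse c"])
    qed
    show "trans (proj_rel smul)"
    proof (rule transI)
      fix x y z assume "(x, y) \<in> proj_rel smul" "(y, z) \<in> proj_rel smul"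
      then obtain c d where "x \<noteq> 0" "z \<noteq> 0" "c \<noteq> 0" "d \<noteq> 0" "y = smul c x" "z = smul d y"
        by (auto simp: proj_rel_def)
      then show "(x, z) \<in> proj_rel smul"
        by (auto simp: proj_rel_def intro!: exI[of _ "d * c"])
    qed
  qed
qed

lemma proj_class_in_proj_space: "x \<noteq> 0 \<Longrightarrow> proj_class smul x \<in> proj_space smul"
  by (auto simp: proj_class_def proj_space_def intro: quotientI)

lemma PGL_act_proj_class:
  assumes "vector_space smul" and "g \<in> carrier (GL smul)" and "x \<noteq> 0"
  shows "PGL_act (PGL_proj smul g) (proj_class smul x) = proj_class smul (g x)"
proof -
  interpret vector_space smul by fact
  interpret g: Vector_Spaces.linear smul smul g using assms(2) by (simp add: GL_def)
  have "inj g" using assms(2) by (simp add: GL_def bij_is_inj)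
  then have gx: "g x \<noteq> 0" using assms(3) by (metis g.zero injD)
  have cls: "proj_class smul y = {smul c y |c. c \<noteq> 0}" if "y \<noteq> 0" for y
    using that by (auto simp: proj_class_def proj_rel_def)
  have prj: "PGL_proj smul g = {smul c \<circ> g |c. c \<noteq> 0}"
    by (auto simp: PGL_proj_def r_coset_def GL_def nonzero_scalars_def)
  show ?thesis
  proof (intro equalityI subsetI)
    fix z assume "z \<in> PGL_act (PGL_proj smul g) (proj_class smul x)"
    then obtain c d where "c \<noteq> 0" "d \<noteq> 0" "z = smul c (g (smul d x))"
      unfolding PGL_act_def cls[OF assms(3)] prj by auto
    then have "c * d \<noteq> 0" "z = smul (c * d) (g x)" by (auto simp: g.scale)
    then show "z \<in> proj_class smul (g x)" unfolding cls[OF gx] by blast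
  next
    fix z assume "z \<in> proj_class smul (g x)"
    then obtain c where "c \<noteq> 0" "z = (smul c \<circ> g) (smul 1 x)" unfolding cls[OF gx] by auto
    then show "z \<in> PGL_act (PGL_proj smul g) (proj_class smul x)"
      unfolding PGL_act_def cls[OF assms(3)] prj
      by (intro CollectI exI[of _ "smul c \<circ> g"] exI[of _ "smul 1 x"]) (auto intro: exI[of _ 1])
  qed
qed

end

(* If the line through x is invariant, SO(3) acts on x through a homomorphism into the
   multiplicative group of the field. Such a homomorphism is trivial: SO(3) is generated by
   half-turns, which are all conjugate, and the half-turns about two orthogonal axes multiply
   to a third half-turn, so their common value c satisfies c * c = c. *)
theory Submission
  imports Defs
begin

text \<open>For a unit vector \<open>u\<close> this is the rotation by the angle \<pi> about the
  line through \<open>u\<close>: it fixes the component along \<open>u\<close> and negates the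
  orthogonal one. For other \<open>u\<close> it is not a rotation.\<close>

definition half_turn :: "real^3 \<Rightarrow> real^3^3" where
  "half_turn u = matrix (\<lambda>x. (2 * (u \<bullet> x)) *\<^sub>R u - x)"

lemma half_turn_apply: "half_turn u *v x = (2 * (u \<bullet> x)) *\<^sub>R u - x"
proof -
  have "linear (\<lambda>x. (2 * (u \<bullet> x)) *\<^sub>R u - x)"
    by (intro linearI) (simp_all add: inner_add_right algebra_simps)
  then show ?thesis
    unfolding half_turn_def by (simp add: matrix_vector_mul)
qed

lemma matrix_eqI:
  fixes A B :: "real^'n^'m"
  shows "(\<And>x. A *v x = B *v x) \<Longrightarrow> A = B"
  by (simp add: matrix_eq)

lemma rotation_matrix_half_turn:
  assumes "norm u = 1"
  shows "rotation_matrix (half_turn u)"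
proof -
  have uu: "u \<bullet> u = 1" using assms by (simp add: norm_eq_1)
  have "orthogonal_transformation ((*v) (half_turn u))"
    unfolding orthogonal_transformation_def
    using uu by (auto simp: half_turn_apply inner_diff_left inner_diff_right inner_commute algebra_simps)
  then have "orthogonal_matrix (half_turn u)"
    by (simp add: orthogonal_transformation_matrix)
  moreover have "half_turn u $ i $ j = 2 * u $ i * u $ j - (if i = j then 1 else 0)" for i j
    by (simp add: half_turn_def matrix_def inner_axis) (simp add: axis_def)
  \<comment> \<open>The eigenvalues are \<open>2 * (u \<bullet> u) - 1\<close> along
    \<open>u\<close> and -1 twice on the orthogonal plane; the expansion of the determinant confirms
    their product.\<close>
  then have "det (half_turn u) = 2 * (u \<bullet> u) - 1"
    by (simp add: det_3 inner_vec_def sum_3) (simp add: algebra_simps)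
  ultimately show ?thesis
    using uu by (simp add: rotation_matrix_def)
qed

text \<open>The axis bisects the angle between \<open>a\<close> and \<open>b\<close>, so it stays in
  the plane orthogonal to \<open>n\<close> that contains both. For antipodal vectors the bisector
  \<open>a + b\<close> vanishes, and an axis in that plane perpendicular to \<open>a\<close> takes
  its place.\<close>

lemma exists_half_turn_orthogonal:
  fixes a b n :: "real^3"
  assumes "norm a = 1" "norm b = 1" "n \<noteq> 0" "n \<bullet> a = 0" "n \<bullet> b = 0"
  obtains u where "norm u = 1" "n \<bullet> u = 0" "half_turn u *v a = b"
proof (cases "a + b = 0")
  case True
  \<comment> \<open>Orthogonal to both \<open>n\<close> and \<open>a\<close>, and nonzero because
    these two are nonzero and orthogonal; the half-turn about it negates \<open>a\<close>.\<close>
  define w where "w = cross3 n a"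
  have "w \<noteq> 0"
    using assms norm_and_cross_eq_0[of n a] by (auto simp: w_def)
  moreover have "n \<bullet> w = 0" "w \<bullet> a = 0"
    by (simp_all add: w_def dot_cross_self)
  moreover have "b = - a" using True by (simp add: add_eq_0_iff)
  ultimately show ?thesis
    by (intro that[of "w /\<^sub>R norm w"]) (auto simp: half_turn_apply)
next
  case False
  define w where "w = a + b"
  have ab: "a \<bullet> a = 1" "b \<bullet> b = 1" using assms by (simp_all add: norm_eq_1)
  \<comment> \<open>Both sides are \<open>2 + 2 * (a \<bullet> b)\<close>. Hence the coefficient of
    \<open>w\<close> in the image of \<open>a\<close> is 1, and that image is
    \<open>w - a = b\<close>.\<close>
  have "w \<bullet> w = 2 * (w \<bullet> a)"
    using ab by (simp add: w_def inner_add_left inner_add_right inner_commute)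
  moreover have "w \<bullet> w = norm w * norm w" by (simp add: dot_square_norm power2_eq_square)
  moreover have "norm w \<noteq> 0" using False by (simp add: w_def)
  ultimately have "2 * (w \<bullet> a) / (norm w * norm w) = 1"
    by (metis divide_self_if mult_eq_0_iff)
  moreover have "half_turn (w /\<^sub>R norm w) *v a = (2 * (w \<bullet> a) / (norm w * norm w)) *\<^sub>R w - a"
    by (simp add: half_turn_apply divide_inverse mult_ac)
  ultimately have "half_turn (w /\<^sub>R norm w) *v a = w - a"
    by (simp only: scaleR_one)
  moreover have "n \<bullet> w = 0" using assms by (simp add: w_def inner_add_right)
  ultimately show ?thesis
    using \<open>norm w \<noteq> 0\<close> by (intro that[of "w /\<^sub>R norm w"]) (auto simp: w_def)
qed

text \<open>Two vectors span at most a plane, so three-space contains a common nonzero normal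
  \<open>n\<close>, as the orthogonal version requires.\<close>

lemma exists_half_turn:
  fixes a b :: "real^3"
  assumes "norm a = 1" "norm b = 1"
  obtains u where "norm u = 1" "half_turn u *v a = b"
proof -
  have "dim {a, b} \<le> card {a, b}" by (rule dim_le_card') simp
  also have "\<dots> \<le> 2" by (simp add: card_insert_if)
  finally have "dim {a, b} < DIM(real^3)" by simp
  then obtain n where "n \<noteq> 0" "\<And>y. y \<in> span {a, b} \<Longrightarrow> orthogonal n y"
    using orthogonal_to_subspace_exists by blast
  then have "n \<bullet> a = 0" "n \<bullet> b = 0"
    by (auto simp: orthogonal_def span_base)
  with assms \<open>n \<noteq> 0\<close> show ?thesis
    using exists_half_turn_orthogonal that by metis
qed

text \<open>A rotation preserves inner products, so conjugation by \<open>K\<close> only moves the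
  axis. Together with \<open>exists_half_turn\<close> this makes all half-turns about unit vectors
  conjugate.\<close>

lemma half_turn_conjugate:
  assumes "rotation_matrix K"
  shows "K ** half_turn u = half_turn (K *v u) ** K"
proof (rule matrix_eqI)
  have "orthogonal_transformation ((*v) K)"
    using assms by (simp add: rotation_matrix_def orthogonal_transformation_matrix)
  then have "(K *v u) \<bullet> (K *v x) = u \<bullet> x" for x
    by (simp add: orthogonal_transformation_def)
  then show "(K ** half_turn u) *v x = (half_turn (K *v u) ** K) *v x" for x
    by (simp add: matrix_vector_mul_assoc[symmetric] half_turn_apply
        matrix_vector_mult_diff_distrib matrix_vector_mult_scaleR)
qed

text \<open>In coordinates: diag(1,-1,-1) times diag(-1,1,-1) is diag(-1,-1,1).\<close>

lemma half_turn_orthogonal_mult: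
  "half_turn (axis 1 1) ** half_turn (axis 2 1) = half_turn (axis 3 1)"
proof (rule matrix_eqI)
  fix x :: "real^3"
  show "(half_turn (axis 1 1) ** half_turn (axis 2 1)) *v x = half_turn (axis 3 1) *v x"
    by (simp add: matrix_vector_mul_assoc[symmetric] half_turn_apply vec_eq_iff forall_3
        inner_axis' inner_diff_right) (simp add: axis_def)
qed

text \<open>Rotations preserve cross products, so the third column is the cross product of the first
  two.\<close>

lemma rotation_matrix_eqI:
  fixes A B :: "real^3^3"
  assumes "rotation_matrix A" "rotation_matrix B"
    and "A *v axis 1 1 = B *v axis 1 1" "A *v axis 2 1 = B *v axis 2 1"
  shows "A = B"
proof -
  have "A *v axis 3 1 = B *v axis 3 1"
    using cross_rotation_matrix[OF assms(1), of "axis 1 1" "axis 2 1"]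
      cross_rotation_matrix[OF assms(2), of "axis 1 1" "axis 2 1"] assms(3,4)
    by (simp only: cross_basis)
  with assms(3,4) show ?thesis
    by (simp add: matrix_vector_mult_basis column_def vec_eq_iff forall_3)
qed

text \<open>Every rotation is a product of three half-turns, so it suffices that \<open>f\<close> is
  1 on half-turns.\<close>

lemma rotation_character_trivial:
  fixes f :: "real^3^3 \<Rightarrow> 'f::field"
  assumes mult: "\<And>A B. rotation_matrix A \<Longrightarrow> rotation_matrix B \<Longrightarrow> f (A ** B) = f A * f B"
    and nz: "\<And>A. rotation_matrix A \<Longrightarrow> f A \<noteq> 0"
    and R: "rotation_matrix R"
  shows "f R = 1"
proof -
  note rot = rotation_matrix_half_turn
  let ?e = "\<lambda>i. axis i 1 :: real^3"
  have e: "norm (?e i) = 1" for i by simp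
  have conj: "f (half_turn a) = f (half_turn b)" if ab: "norm a = 1" "norm b = 1" for a b
  proof -
    obtain u where u: "norm u = 1" "half_turn u *v a = b"
      using exists_half_turn[OF ab] by blast
    \<comment> \<open>The half-turn about \<open>u\<close> conjugates the one about \<open>a\<close>
      into the one about \<open>b\<close>; since the values of \<open>f\<close> commute and are
      nonzero, the factor \<open>f (half_turn u)\<close> cancels.\<close>
    have "f (half_turn u) * f (half_turn a) = f (half_turn b) * f (half_turn u)"
      using half_turn_conjugate[OF rot[OF u(1)], of a] u ab by (metis mult rot)
    then show ?thesis using nz[OF rot[OF u(1)]] by simp
  qed
  have half: "f (half_turn u) = 1" if u: "norm u = 1" for u
  proof -
    have "f (half_turn u) * f (half_turn u) = f (half_turn u)"
      using mult[OF rot[OF e] rot[OF e]] half_turn_orthogonal_mult conj[OF u e] by metis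
    then show ?thesis using nz[OF rot[OF u]] by simp
  qed
  have iso: "norm (A *v x) = norm x" "(A *v x) \<bullet> (A *v y) = x \<bullet> y"
    if "rotation_matrix A" for A :: "real^3^3" and x y
  proof -
    have "orthogonal_transformation ((*v) A)"
      using that by (simp add: rotation_matrix_def orthogonal_transformation_matrix)
    then show "norm (A *v x) = norm x" "(A *v x) \<bullet> (A *v y) = x \<bullet> y"
      by (simp_all add: orthogonal_transformation_def orthogonal_transformation_norm)
  qed
  have prod: "rotation_matrix (A ** B)" if "rotation_matrix A" "rotation_matrix B" for A B :: "real^3^3"
    using that by (simp add: rotation_matrix_def orthogonal_matrix_mul det_mul)
  \<comment> \<open>Moving the image of the first basis vector back leaves a rotation
    \<open>S\<close> that fixes this vector.\<close>
  obtain w where w: "norm w = 1" "half_turn w *v (R *v ?e 1) = ?e 1"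
    using exists_half_turn[of "R *v ?e 1" "?e 1"] iso(1)[OF R] by auto
  define S where "S = half_turn w ** R"
  have S: "rotation_matrix S" using R prod rot[OF w(1)] by (simp add: S_def)
  have S1: "S *v ?e 1 = ?e 1" using w by (simp add: S_def matrix_vector_mul_assoc)
  have "?e 1 \<bullet> (S *v ?e 2) = 0"
    using iso(2)[OF S, of "?e 1" "?e 2"] S1 by (simp add: inner_axis_axis)
  then obtain u where u: "norm u = 1" "?e 1 \<bullet> u = 0" "half_turn u *v ?e 2 = S *v ?e 2"
    using exists_half_turn_orthogonal[of "?e 2" "S *v ?e 2" "?e 1"] iso(1)[OF S]
    by (auto simp: inner_axis_axis)
  \<comment> \<open>Both axes are orthogonal to \<open>?e 1\<close>, so the two half-turns negate it
    twice. The second factor fixes \<open>?e 2\<close>, and the first carries it to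
    \<open>S *v ?e 2\<close> by the choice of \<open>u\<close>.\<close>
  have "S = half_turn u ** half_turn (?e 2)"
  proof (rule rotation_matrix_eqI[OF S prod[OF rot[OF u(1)] rot[OF e]]])
    show "S *v ?e 1 = (half_turn u ** half_turn (?e 2)) *v ?e 1"
      using S1 u(2) by (simp add: matrix_vector_mul_assoc[symmetric] half_turn_apply inner_commute
          inner_axis_axis inner_diff_right)
    show "S *v ?e 2 = (half_turn u ** half_turn (?e 2)) *v ?e 2"
      using u(3) by (simp add: matrix_vector_mul_assoc[symmetric] half_turn_apply[of "?e 2"]
          inner_axis_axis scaleR_2)
  qed
  then have "f S = 1" using u by (simp add: mult rot half)
  then show ?thesis using mult[OF rot[OF w(1)] R] half[OF w(1)] by (simp add: S_def)
qed

lemma (in vector_space) proj_class_eq_iff: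
  assumes "x \<noteq> 0" "y \<noteq> 0"
  shows "proj_class scale y = proj_class scale x \<longleftrightarrow> (\<exists>c. c \<noteq> 0 \<and> y = scale c x)"
proof -
  have "proj_class scale y = proj_class scale x \<longleftrightarrow> (x, y) \<in> proj_rel scale"
    using eq_equiv_class_iff[OF proj_rel_equiv[OF vector_space_axioms], of x y] assms
    unfolding proj_class_def by auto
  then show ?thesis using assms by (simp add: proj_rel_def)
qed

text \<open>The scalar field is left abstract, so that the real and the complex case are instances
  of one argument.\<close>

lemma projective_invariance_iff_linear_invariance:
  fixes smul :: "'f::{field,topological_space} \<Rightarrow> 'v::topological_ab_group_add \<Rightarrow> 'v"
  assumes rep: "linear_representation smul \<rho>h" and x: "x \<noteq> 0"
  shows "(\<forall>R\<in>carrier SO3. PGL_act ((PGL_proj smul \<circ> \<rho>h) R) (proj_class smul x) = proj_class smul x)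
     \<longleftrightarrow> (\<forall>R\<in>carrier SO3. \<rho>h R x = x)" (is "?P \<longleftrightarrow> ?L")
proof -
  interpret topological_vector_space smul
    using rep by (simp add: linear_representation_def)
  have hom: "\<rho>h \<in> hom SO3 (GL smul)"
    using rep by (simp add: linear_representation_def)
  have GL: "\<rho>h R \<in> carrier (GL smul)" if "R \<in> carrier SO3" for R
    using hom that by (rule hom_in_carrier)
  have act: "PGL_act ((PGL_proj smul \<circ> \<rho>h) R) (proj_class smul x) = proj_class smul (\<rho>h R x)"
    if "R \<in> carrier SO3" for R
    using PGL_act_proj_class[OF vector_space_axioms GL[OF that] x] by simp
  have lin: "Vector_Spaces.linear smul smul (\<rho>h R)" if "R \<in> carrier SO3" for R
    using GL[OF that] by (simp add: GL_def)
  have ne: "\<rho>h R x \<noteq> 0" if R: "R \<in> carrier SO3" for R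
  proof -
    have "inj (\<rho>h R)" using GL[OF R] by (simp add: GL_def bij_is_inj)
    then show ?thesis using module_hom.zero[OF Vector_Spaces.linear.axioms(3)[OF lin[OF R]]] x by (metis injD)
  qed
  show ?thesis
  proof
    assume ?P
    then have "\<forall>R\<in>carrier SO3. \<exists>c. c \<noteq> 0 \<and> \<rho>h R x = smul c x"
      using act proj_class_eq_iff[OF x ne] by metis
    then obtain f where f: "\<And>R. R \<in> carrier SO3 \<Longrightarrow> f R \<noteq> 0"
      "\<And>R. R \<in> carrier SO3 \<Longrightarrow> \<rho>h R x = smul (f R) x"
      by metis
    \<comment> \<open>The eigenvalues \<open>f\<close> were chosen separately for each rotation, but
      \<open>x \<noteq> 0\<close> determines them; computing the action of \<open>A ** B\<close> on
      \<open>x\<close> in two ways therefore makes \<open>f\<close> multiplicative.\<close>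
    have "f (A ** B) = f A * f B" if AB: "A \<in> carrier SO3" "B \<in> carrier SO3" for A B
    proof -
      have "A ** B \<in> carrier SO3"
        using monoid.m_closed[OF group.is_monoid[OF SO3_group] AB] by (simp add: SO3_def)
      then have "smul (f (A ** B)) x = \<rho>h (A ** B) x"
        using f(2) by simp
      also have "\<dots> = \<rho>h A (\<rho>h B x)"
        using hom_mult[OF hom AB] by (simp add: SO3_def GL_def)
      also have "\<dots> = smul (f B) (\<rho>h A x)"
        using f(2) AB module_hom.scale[OF Vector_Spaces.linear.axioms(3)[OF lin[OF AB(1)]]] by simp
      also have "\<dots> = smul (f A * f B) x"
        using f(2) AB by (simp add: mult.commute)
      finally show ?thesis using x by simp
    qed
    then have "f R = 1" if "R \<in> carrier SO3" for R
      using rotation_character_trivial[of f R] f(1) that by (simp add: SO3_def)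
    then show ?L using f(2) by simp
  next
    assume ?L
    then show ?P using act by simp
  qed
qed

theorem corollary1p17:
  shows
    "(\<forall>(smul :: real \<Rightarrow> 'v::topological_ab_group_add \<Rightarrow> 'v) \<rho>h \<rho>.
        linear_representation smul \<rho>h \<and> \<rho> = PGL_proj smul \<circ> \<rho>h \<longrightarrow>
        (\<forall>x v. x \<noteq> 0 \<and> v = proj_class smul x \<longrightarrow>
          ((\<forall>R\<in>carrier SO3. PGL_act (\<rho> R) v = v) \<longleftrightarrow> (\<forall>R\<in>carrier SO3. \<rho>h R x = x)))) \<and>
     (\<forall>(smul :: complex \<Rightarrow> 'w::topological_ab_group_add \<Rightarrow> 'w) \<rho>h \<rho>.
        linear_representation smul \<rho>h \<and> \<rho> = PGL_proj smul \<circ> \<rho>h \<longrightarrow>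
        (\<forall>x v. x \<noteq> 0 \<and> v = proj_class smul x \<longrightarrow>
          ((\<forall>R\<in>carrier SO3. PGL_act (\<rho> R) v = v) \<longleftrightarrow> (\<forall>R\<in>carrier SO3. \<rho>h R x = x))))"
  by (intro conjI allI impI; elim conjE; hypsubst)
    (rule projective_invariance_iff_linear_invariance; assumption)+

end
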